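(* Let $A$ be an associative algebra and $M$ an $A$-bimodule. Then the graded vector space $C^{*}(M,A)=\bigoplus_{n\ge 0}\mathrm{Hom}(M^{\otimes n},A\oplus A)$ (with $\mathrm{Hom}(M^{\otimes n},A\oplus A)$ in degree $n$), equipped with the bracket $\llbracket\ ,\ \rrbracket$ defined in the context, is a graded Lie algebra. Moreover, a pair $(R,S)$ of linear maps from $M$ to $A$ is a generalized Rota-Baxter system on $M$ over $A$ if and only if $(R,S)\in C^{1}(M,A)=\mathrm{Hom}(M,A\oplus A)$ is a Maurer-Cartan element of $(C^{*}(M,A),\llbracket\ ,\ \rrbracket)$, i.e. $\llbracket (R,S),(R,S)\rrbracket=0$.
   Context: All vector spaces, linear maps and tensor products are over a field $\mathbb{K}$ of characteristic zero; associative algebras are not assumed unital. An $A$-bimodule $M$ has left and right actions $a\cdot u$, $u\cdot a$ with $(ab)\cdot u=a\cdot(b\cdot u)$, $(a\cdot u)\cdot b=a\cdot(u\cdot b)$, $(u\cdot a)\cdot b=u\cdot(ab)$. A generalized Rota-Baxter system on $M$ over $A$ is a pair of linear maps $R,S:M\to A$ with $R(u)R(v)=R(R(u)\cdot v+u\cdot S(v))$ and $S(u)S(v)=S(R(u)\cdot v+u\cdot S(v))$ for all $u,v\in M$. The bracket: for $F=(F_1,F_2)\in\mathrm{Hom}(M^{\otimes m},A\oplus A)$ and $G=(G_1,G_2)\in\mathrm{Hom}(M^{\otimes n},A\oplus A)$, $m,n\ge 0$ (components with respect to the two factors of $A\oplus A$), $\llbracket F,G\rrbracket\in\mathrm{Hom}(M^{\otimes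 (m+n)},A\oplus A)$ has components, for $k=1,2$, \begin{align*} \llbracket F,G\rrbracket_k(u_1,\dots,u_{m+n})=&\sum_{i=1}^m(-1)^{(i-1)n}F_k(u_1,\dots,u_{i-1},G_1(u_i,\dots,u_{i+n-1})\cdot u_{i+n},\dots,u_{m+n})\\ &-\sum_{i=1}^m(-1)^{in}F_k(u_1,\dots,u_{i-1},u_i\cdot G_2(u_{i+1},\dots,u_{i+n}),u_{i+n+1},\dots,u_{m+n})\\ &-(-1)^{mn}\Big\{\sum_{i=1}^n(-1)^{(i-1)m}G_k(u_1,\dots,u_{i-1},F_1(u_i,\dots,u_{i+m-1})\cdot u_{i+m},\dots,u_{m+n})\\ &\qquad-\sum_{i=1}^n(-1)^{im}G_k(u_1,\dots,u_{i-1},u_i\cdot F_2(u_{i+1},\dots,u_{i+m}),u_{i+m+1},\dots,u_{m+n})\Big\}\\ &+(-1)^{mn}\big[F_k(u_1,\dots,u_m)G_k(u_{m+1},\dots,u_{m+n})-(-1)^{mn}G_k(u_1,\dots,u_n)F_k(u_{n+1},\dots,u_{m+n})\big]. \end{align*} Here a map with zero arguments is an element of $A\oplus A$ and empty sums are $0$; e.g. $\llbracket(a,b),(c,d)\rrbracket=(ac-ca,bd-db)$, and $\llbracket F,(a,b)\rrbracket_1(u_1,\dots,u_m)=\sum_{i}F_1(u_1,\dots,a\cdot u_i-u_i\cdot b,\dots,u_m)+F_1(u_1,\dots,u_m)a-aF_1(u_1,\dots,u_m)$. *)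

theory Defs
  imports "HOL-Analysis.Product_Vector" "HOL-Library.Function_Algebras"
begin

text \<open>The class \<open>ring\<close> provides an associative, not necessarily unital multiplication.\<close>

locale assoc_algebra = vector_space scale
  for scale :: "'k::field \<Rightarrow> 'a::ring \<Rightarrow> 'a" +
  assumes scale_mult_left: "scale c a * b = scale c (a * b)"
    and scale_mult_right: "a * scale c b = scale c (a * b)"

locale algebra_bimodule = A: assoc_algebra sA + M: vector_space sM
  for sA :: "'k::field \<Rightarrow> 'a::ring \<Rightarrow> 'a"
    and sM :: "'k \<Rightarrow> 'm::ab_group_add \<Rightarrow> 'm" +
  fixes lact :: "'a \<Rightarrow> 'm \<Rightarrow> 'm"
    and ract :: "'m \<Rightarrow> 'a \<Rightarrow> 'm"
  assumes linear_lact: "Vector_Spaces.linear sM sM (\<lambda>u. lact a u)"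
    and linear_lact_algebra: "Vector_Spaces.linear sA sM (\<lambda>a. lact a u)"
    and linear_ract: "Vector_Spaces.linear sM sM (\<lambda>u. ract u a)"
    and linear_ract_algebra: "Vector_Spaces.linear sA sM (\<lambda>a. ract u a)"
    and lact_mult: "lact (a * b) u = lact a (lact b u)"
    and lact_ract: "ract (lact a u) b = lact a (ract u b)"
    and ract_mult: "ract (ract u a) b = ract u (a * b)"

definition generalized_rota_baxter_system ::
  "('k::field \<Rightarrow> 'a::ring \<Rightarrow> 'a) \<Rightarrow> ('k \<Rightarrow> 'm::ab_group_add \<Rightarrow> 'm) \<Rightarrow>
   ('a \<Rightarrow> 'm \<Rightarrow> 'm) \<Rightarrow> ('m \<Rightarrow> 'a \<Rightarrow> 'm) \<Rightarrow> ('m \<Rightarrow> 'a) \<Rightarrow> ('m \<Rightarrow> 'a) \<Rightarrow> bool"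
  where "generalized_rota_baxter_system sA sM lact ract R S \<longleftrightarrow>
    Vector_Spaces.linear sM sA R \<and> Vector_Spaces.linear sM sA S \<and>
    (\<forall>u v. R u * R v = R (lact (R u) v + ract u (S v))) \<and>
    (\<forall>u v. S u * S v = S (lact (R u) v + ract u (S v)))"

text \<open>\<open>V\<close> is the internal direct sum of the subspaces \<open>L n\<close>.\<close>

locale graded_vector_space = vector_space scale
  for scale :: "'k::field \<Rightarrow> 'v::ab_group_add \<Rightarrow> 'v" +
  fixes V :: "'v set" and L :: "nat \<Rightarrow> 'v set"
  assumes subspace_total: "subspace V"
    and subspace_component: "subspace (L n)"
    and component_subset: "L n \<subseteq> V"
    and direct_sum: "x \<in> V \<Longrightarrow>
      \<exists>!f. (\<forall>n. f n \<in> L n) \<and> finite {n. f n \<noteq> 0} \<and> x = (\<Sum>n | f n \<noteq> 0. f n)"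

locale graded_lie_algebra = graded_vector_space scale V L
  for scale :: "'k::field \<Rightarrow> 'v::ab_group_add \<Rightarrow> 'v"
    and V :: "'v set" and L :: "nat \<Rightarrow> 'v set" +
  fixes bracket :: "'v \<Rightarrow> 'v \<Rightarrow> 'v"
  assumes bracket_closed: "\<lbrakk>x \<in> V; y \<in> V\<rbrakk> \<Longrightarrow> bracket x y \<in> V"
    and bracket_add_left:
      "\<lbrakk>x \<in> V; y \<in> V; z \<in> V\<rbrakk> \<Longrightarrow> bracket (x + y) z = bracket x z + bracket y z"
    and bracket_add_right:
      "\<lbrakk>x \<in> V; y \<in> V; z \<in> V\<rbrakk> \<Longrightarrow> bracket x (y + z) = bracket x y + bracket x z"
    and bracket_scale_left:
      "\<lbrakk>x \<in> V; y \<in> V\<rbrakk> \<Longrightarrow> bracket (scale c x) y = scale c (bracket x y)"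
    and bracket_scale_right:
      "\<lbrakk>x \<in> V; y \<in> V\<rbrakk> \<Longrightarrow> bracket x (scale c y) = scale c (bracket x y)"
    and bracket_degree: "\<lbrakk>x \<in> L m; y \<in> L n\<rbrakk> \<Longrightarrow> bracket x y \<in> L (m + n)"
    and graded_antisymmetry:
      "\<lbrakk>x \<in> L m; y \<in> L n\<rbrakk> \<Longrightarrow> bracket x y = - scale ((-1) ^ (m * n)) (bracket y x)"
    and graded_jacobi: "\<lbrakk>x \<in> L l; y \<in> L m; z \<in> L n\<rbrakk> \<Longrightarrow>
      bracket x (bracket y z) =
        bracket (bracket x y) z + scale ((-1) ^ (l * m)) (bracket y (bracket x z))"

definition maurer_cartan ::
  "(nat \<Rightarrow> 'v set) \<Rightarrow> ('v \<Rightarrow> 'v \<Rightarrow> 'v::zero) \<Rightarrow> 'v \<Rightarrow> bool"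
  where "maurer_cartan L bracket x \<longleftrightarrow> x \<in> L 1 \<and> bracket x x = 0"

text \<open>
  A linear map on \<open>M\<^sup>\<otimes>\<^sup>n\<close> is represented by the corresponding \<open>n\<close>-multilinear map, given as
  a function on lists of length \<open>n\<close> (and zero on all other lists, so that equality of maps is
  equality of functions). For \<open>n = 0\<close> this is just an element of \<open>A \<oplus> A\<close>, the value at \<open>[]\<close>.

  With this encoding the direct sum over all \<open>n\<close> consists of functions on lists of arbitrary
  length: the degree \<open>n\<close> component of such a function is its restriction to lists of length \<open>n\<close>.
\<close>

type_synonym ('m, 'a) cochain = "'m list \<Rightarrow> 'a \<times> 'a"

definition cochain_scale ::
  "('k::field \<Rightarrow> 'a::ring \<Rightarrow> 'a) \<Rightarrow> 'k \<Rightarrow> ('m, 'a) cochain \<Rightarrow> ('m, 'a) cochain"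
  where "cochain_scale sA c F = (\<lambda>us. module_prod.scale sA sA c (F us))"

definition cochains_deg ::
  "('k::field \<Rightarrow> 'a::ring \<Rightarrow> 'a) \<Rightarrow> ('k \<Rightarrow> 'm::ab_group_add \<Rightarrow> 'm) \<Rightarrow> nat \<Rightarrow> ('m, 'a) cochain set"
  where "cochains_deg sA sM n = {F.
    (\<forall>us. length us \<noteq> n \<longrightarrow> F us = 0) \<and>
    (\<forall>us i. length us = n \<longrightarrow> i < n \<longrightarrow>
      Vector_Spaces.linear sM (module_prod.scale sA sA) (\<lambda>u. F (us[i := u])))}"

definition component :: "nat \<Rightarrow> ('m, 'a::ring) cochain \<Rightarrow> ('m, 'a) cochain"
  where "component n F = (\<lambda>us. if length us = n then F us else 0)"

definition cochains ::
  "('k::field \<Rightarrow> 'a::ring \<Rightarrow> 'a) \<Rightarrow> ('k \<Rightarrow> 'm::ab_group_add \<Rightarrow> 'm) \<Rightarrow> ('m, 'a) cochain set"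
  where "cochains sA sM = {F.
    (\<forall>n. component n F \<in> cochains_deg sA sM n) \<and> finite {n. component n F \<noteq> 0}}"

definition pair_cochain :: "('m \<Rightarrow> 'a::ring) \<Rightarrow> ('m \<Rightarrow> 'a) \<Rightarrow> ('m, 'a) cochain"
  where "pair_cochain R S = (\<lambda>us. case us of [u] \<Rightarrow> (R u, S u) | _ \<Rightarrow> 0)"

text \<open>
  \<open>p\<close> is \<open>fst\<close> or \<open>snd\<close>, selecting the component of the bracket. Indices \<open>i\<close> count arguments
  from 1, i.e. \<open>u\<^sub>i\<close> is \<open>us ! (i - 1)\<close>; thus \<open>take (i - 1) us\<close> is \<open>u\<^sub>1, \<dots>, u\<^sub>i\<^sub>-\<^sub>1\<close>,
  and \<open>take n (drop i us)\<close> is \<open>u\<^sub>i\<^sub>+\<^sub>1, \<dots>, u\<^sub>i\<^sub>+\<^sub>n\<close>.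
\<close>

definition bracket_component ::
  "('k::field \<Rightarrow> 'a::ring \<Rightarrow> 'a) \<Rightarrow> ('a \<Rightarrow> 'm \<Rightarrow> 'm) \<Rightarrow> ('m \<Rightarrow> 'a \<Rightarrow> 'm) \<Rightarrow> ('a \<times> 'a \<Rightarrow> 'a) \<Rightarrow>
   nat \<Rightarrow> nat \<Rightarrow> ('m, 'a) cochain \<Rightarrow> ('m, 'a) cochain \<Rightarrow> 'm list \<Rightarrow> 'a"
  where "bracket_component sA lact ract p m n F G us =
    (\<Sum>i=1..m. sA ((-1) ^ ((i - 1) * n))
      (p (F (take (i - 1) us @ [lact (fst (G (take n (drop (i - 1) us)))) (us ! (i + n - 1))]
             @ drop (i + n) us))))
    - (\<Sum>i=1..m. sA ((-1) ^ (i * n))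
      (p (F (take (i - 1) us @ [ract (us ! (i - 1)) (snd (G (take n (drop i us))))]
             @ drop (i + n) us))))
    - sA ((-1) ^ (m * n))
      ((\<Sum>i=1..n. sA ((-1) ^ ((i - 1) * m))
        (p (G (take (i - 1) us @ [lact (fst (F (take m (drop (i - 1) us)))) (us ! (i + m - 1))]
               @ drop (i + m) us))))
       - (\<Sum>i=1..n. sA ((-1) ^ (i * m))
        (p (G (take (i - 1) us @ [ract (us ! (i - 1)) (snd (F (take m (drop i us))))]
               @ drop (i + m) us)))))
    + sA ((-1) ^ (m * n))
      (p (F (take m us)) * p (G (drop m us))
       - sA ((-1) ^ (m * n)) (p (G (take n us)) * p (F (drop n us))))"

definition bracket_deg ::
  "('k::field \<Rightarrow> 'a::ring \<Rightarrow> 'a) \<Rightarrow> ('a \<Rightarrow> 'm \<Rightarrow> 'm) \<Rightarrow> ('m \<Rightarrow> 'a \<Rightarrow> 'm) \<Rightarrow>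
   nat \<Rightarrow> nat \<Rightarrow> ('m, 'a) cochain \<Rightarrow> ('m, 'a) cochain \<Rightarrow> ('m, 'a) cochain"
  where "bracket_deg sA lact ract m n F G = (\<lambda>us.
    if length us = m + n
    then (bracket_component sA lact ract fst m n F G us,
          bracket_component sA lact ract snd m n F G us)
    else 0)"

text \<open>
  The bilinear extension to the direct sum. At a list of length \<open>l\<close> only the brackets of the
  components of degrees \<open>m\<close> and \<open>l - m\<close> contribute.
\<close>

definition cochain_bracket ::
  "('k::field \<Rightarrow> 'a::ring \<Rightarrow> 'a) \<Rightarrow> ('a \<Rightarrow> 'm \<Rightarrow> 'm) \<Rightarrow> ('m \<Rightarrow> 'a \<Rightarrow> 'm) \<Rightarrow>
   ('m, 'a) cochain \<Rightarrow> ('m, 'a) cochain \<Rightarrow> ('m, 'a) cochain"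
  where "cochain_bracket sA lact ract F G = (\<lambda>us.
    \<Sum>m\<le>length us. bracket_deg sA lact ract m (length us - m)
      (component m F) (component (length us - m) G) us)"

lemma component_cochains_deg:
  "F \<in> cochains_deg sA sM m \<Longrightarrow> component l F = (if l = m then F else 0)"
  by (auto simp: cochains_deg_def component_def fun_eq_iff)

lemma cochains_deg_zero_entry:
  assumes F: "F \<in> cochains_deg sA sM m" and len: "Suc (length xs + length ys) = m"
  shows "F (xs @ 0 # ys) = 0"
proof -
  have "length (xs @ 0 # ys) = m" "length xs < m"
    using len by simp_all
  then have "Vector_Spaces.linear sM (module_prod.scale sA sA)
      (\<lambda>u. F ((xs @ 0 # ys)[length xs := u]))"
    using F unfolding cochains_deg_def by blast
  then interpret h: Vector_Spaces.linear sM "module_prod.scale sA sA"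
    "\<lambda>u. F ((xs @ 0 # ys)[length xs := u])" .
  show ?thesis using h.zero by simp
qed

lemma (in algebra_bimodule) act_zero [simp]: "lact 0 u = 0" "ract u 0 = 0"
  using linear_lact_algebra[of u] linear_ract_algebra[of u]
  by (metis module_hom.zero linear_iff_module_hom)+

lemma (in algebra_bimodule) bracket_deg_zero:
  assumes us: "length us = m + n"
    and FG: "F = 0 \<and> G \<in> cochains_deg sA sM n \<or> F \<in> cochains_deg sA sM m \<and> G = 0"
  shows "bracket_deg sA lact ract m n F G us = 0"
  using FG
proof
  assume h: "F = 0 \<and> G \<in> cochains_deg sA sM n"
  have "G (take (i - Suc 0) us @ 0 # drop (i + m) us) = 0" if "i \<in> {1..n}" for i
    using h us that by (intro cochains_deg_zero_entry[where m = n]) auto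
  with h show ?thesis
    by (auto simp: bracket_deg_def bracket_component_def zero_prod_def intro!: sum.neutral)
next
  assume h: "F \<in> cochains_deg sA sM m \<and> G = 0"
  have "F (take (i - Suc 0) us @ 0 # drop (i + n) us) = 0" if "i \<in> {1..m}" for i
    using h us that by (intro cochains_deg_zero_entry[where m = m]) auto
  with h show ?thesis
    by (auto simp: bracket_deg_def bracket_component_def zero_prod_def intro!: sum.neutral)
qed

lemma zero_in_cochains_deg:
  assumes "vector_space sA" "vector_space sM"
  shows "0 \<in> cochains_deg sA sM n"
proof -
  interpret vector_space_prod sA sA using assms by (simp add: vector_space_prod_def vector_space_pair_def)
  show ?thesis using assms p.vector_space_axioms
    by (auto simp: cochains_deg_def Vector_Spaces.linear_iff)
qed

lemma (in algebra_bimodule) cochain_bracket_homogeneous: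
  assumes F: "F \<in> cochains_deg sA sM m" and G: "G \<in> cochains_deg sA sM n"
  shows "cochain_bracket sA lact ract F G = bracket_deg sA lact ract m n F G"
proof
  fix us
  note z = zero_in_cochains_deg[OF A.vector_space_axioms M.vector_space_axioms]
  let ?t = "\<lambda>l. bracket_deg sA lact ract l (length us - l)
      (component l F) (component (length us - l) G) us"
  have t: "?t l = (if l = m then bracket_deg sA lact ract m n F G us else 0)"
    if "l \<le> length us" for l
  proof (cases "l = m \<and> length us - l = n")
    case True
    then show ?thesis using F G by (auto simp: component_cochains_deg)
  next
    case False
    then have "?t l = 0"
      using that z F G
      by (intro bracket_deg_zero) (auto simp: component_cochains_deg[OF F] component_cochains_deg[OF G])
    moreover have "l = m \<Longrightarrow> bracket_deg sA lact ract m n F G us = 0"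
      using False that by (auto simp: bracket_deg_def)
    ultimately show ?thesis by simp
  qed
  have "cochain_bracket sA lact ract F G us =
      (\<Sum>l\<le>length us. if l = m then bracket_deg sA lact ract m n F G us else 0)"
    unfolding cochain_bracket_def by (intro sum.cong refl t) simp
  also have "\<dots> = bracket_deg sA lact ract m n F G us"
    by (auto simp: bracket_deg_def)
  finally show "cochain_bracket sA lact ract F G us = bracket_deg sA lact ract m n F G us" .
qed

end

theory Submission
  imports Defs
begin

text \<open>
  \<open>A \<oplus> A\<close> is an associative algebra, and \<open>M\<close> is a bimodule over it, where \<open>(a, b)\<close> acts on the left
  through \<open>a\<close> and on the right through \<open>b\<close>; so it suffices to treat cochains with values in one
  algebra acting on \<open>M\<close>. The bracket is then the graded commutator of the product \<open>F \<lhd> G\<close> which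
  inserts the value of \<open>G\<close> into all gaps between the arguments of \<open>F\<close>. The operators \<open>T\<^sub>G F = F \<lhd> G\<close>
  satisfy \<open>T\<^sub>H T\<^sub>G - (-1)\<^bsup>nh\<^esup> T\<^sub>G T\<^sub>H = T\<^bsub>[G, H]\<^esub>\<close>, i.e. the product is graded pre-Lie, and the
  graded Jacobi identity is a formal consequence.
  For \<open>T = (R, S)\<close> the bracket \<open>[T, T]\<close> is twice the defect of the Rota-Baxter identities.
\<close>

section \<open>The insertion product on functions of words\<close>

context algebra_bimodule
begin

text \<open>No degree occurs: words of every length are tested. Fixing the first letter therefore
  stays within this class, as inductions on the word require.\<close>

definition multilinear :: "('m list \<Rightarrow> 'a) \<Rightarrow> bool"
  where "multilinear F \<longleftrightarrow> (\<forall>xs ys. Vector_Spaces.linear sM sA (\<lambda>u. F (xs @ u # ys)))"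

text \<open>Models an element placed in the gap before a word. Treating the last gap as the case of
  an empty rest makes left action and right multiplication one operation.\<close>

fun act_head :: "('m list \<Rightarrow> 'a) \<Rightarrow> 'a \<Rightarrow> 'm list \<Rightarrow> 'a"
  where "act_head F a [] = F [] * a"
  | "act_head F a (u # w) = F (lact a u # w)"

text \<open>\<open>C\<close> is a continuation: it receives the value of \<open>G\<close> and the
  unread letters. The default 0 on short words lets \<open>insertion\<close> run through all gaps
  without knowing the degree of \<open>F\<close>.\<close>

definition eval_prefix :: "nat \<Rightarrow> ('m list \<Rightarrow> 'a) \<Rightarrow> ('a \<Rightarrow> 'm list \<Rightarrow> 'a) \<Rightarrow> 'm list \<Rightarrow> 'a"
  where "eval_prefix n G C w = (if n \<le> length w then C (G (take n w)) (drop n w) else 0)"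

text \<open>
  The value of \<open>G\<close> is inserted into each gap of the word, with sign \<open>(-1)\<^bsup>kn\<^esup>\<close> for the gap after
  \<open>k\<close> letters; it acts on the letter to its right, minus the action on the letter to its left,
  and in the last gap it multiplies the value of \<open>F\<close> from the right.
\<close>

fun insertion :: "nat \<Rightarrow> ('m list \<Rightarrow> 'a) \<Rightarrow> ('m list \<Rightarrow> 'a) \<Rightarrow> 'm list \<Rightarrow> 'a"
  where "insertion n G F [] = eval_prefix n G (act_head F) []"
  | "insertion n G F (u # w) = eval_prefix n G (act_head F) (u # w)
      + sA ((-1) ^ n) (insertion n G (\<lambda>v. F (u # v)) w
                        - eval_prefix n G (\<lambda>a v. F (ract u a # v)) w)"

section \<open>Linearity of insertion and of its ingredients\<close>

lemma multilinear_Cons: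
  assumes "multilinear F"
  shows "multilinear (\<lambda>w. F (u # w))"
  unfolding multilinear_def
proof (intro allI)
  fix xs ys
  show "Vector_Spaces.linear sM sA (\<lambda>v. F (u # xs @ v # ys))"
    using assms[unfolded multilinear_def, rule_format, of "u # xs" ys] by simp
qed

lemma linear_first:
  "multilinear F \<Longrightarrow> Vector_Spaces.linear sM sA (\<lambda>u. F (u # w))"
  unfolding multilinear_def by (drule spec[of _ "[]"]) simp

lemma linear_mult_left: "Vector_Spaces.linear sA sA (\<lambda>b. a * b)"
  using A.vector_space_axioms
  by (auto simp: Vector_Spaces.linear_iff A.scale_mult_right distrib_left)

lemma linear_lact_first:
  "multilinear F \<Longrightarrow> Vector_Spaces.linear sA sA (\<lambda>a. F (lact a u # w))"
  using Vector_Spaces.linear_compose[OF linear_lact_algebra[of u] linear_first[of F w]] by (simp add: o_def)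

lemma linear_ract_first:
  "multilinear F \<Longrightarrow> Vector_Spaces.linear sA sA (\<lambda>a. F (ract u a # w))"
  using Vector_Spaces.linear_compose[OF linear_ract_algebra[of u] linear_first[of F w]] by (simp add: o_def)

lemma linear_act_head:
  "multilinear F \<Longrightarrow> Vector_Spaces.linear sA sA (\<lambda>a. act_head F a w)"
  by (cases w) (simp_all add: linear_mult_left linear_lact_first)

lemma act_head_diff: "act_head (\<lambda>v. F v - G v) a w = act_head F a w - act_head G a w"
  by (cases w) (simp_all add: left_diff_distrib)

lemma act_head_add: "act_head (\<lambda>v. F v + G v) a w = act_head F a w + act_head G a w"
  by (cases w) (simp_all add: distrib_right)

lemma act_head_scale: "act_head (\<lambda>v. sA c (F v)) a w = sA c (act_head F a w)"
  by (cases w) (simp_all add: A.scale_mult_left)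

lemma insertion_add:
  "insertion n G (\<lambda>v. F v + F' v) w = insertion n G F w + insertion n G F' w"
  by (induction w arbitrary: F F')
     (simp_all add: eval_prefix_def act_head_add A.scale_right_distrib A.scale_right_diff_distrib)

lemma insertion_scale:
  "insertion n G (\<lambda>v. sA c (F v)) w = sA c (insertion n G F w)"
  by (induction w arbitrary: F)
     (simp_all add: eval_prefix_def act_head_scale A.scale_right_distrib A.scale_right_diff_distrib mult.commute)

lemma insertion_diff:
  "insertion n G (\<lambda>v. F v - F' v) w = insertion n G F w - insertion n G F' w"
  by (induction w arbitrary: F F')
     (simp_all add: eval_prefix_def act_head_diff A.scale_right_distrib A.scale_right_diff_distrib)

lemmas linear_add = module_hom.add[OF module_hom_iff_linear[THEN iffD2]]
  and linear_diff = module_hom.diff[OF module_hom_iff_linear[THEN iffD2]]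
  and linear_scale = module_hom.scale[OF module_hom_iff_linear[THEN iffD2]]

section \<open>Exchange rules for two insertions\<close>

lemma act_head_act_head: "act_head (act_head F a) b w = act_head F (a * b) w"
  by (cases w) (simp_all add: lact_mult mult.assoc)

lemma eval_prefix_add: "eval_prefix n G (\<lambda>a v. C a v + D a v) w = eval_prefix n G C w + eval_prefix n G D w"
  and eval_prefix_diff: "eval_prefix n G (\<lambda>a v. C a v - D a v) w = eval_prefix n G C w - eval_prefix n G D w"
  and eval_prefix_scale: "eval_prefix n G (\<lambda>a v. sA c (C a v)) w = sA c (eval_prefix n G C w)"
  by (simp_all add: eval_prefix_def)

lemma eval_prefix_left:
  assumes C: "\<And>v. Vector_Spaces.linear sA sA (\<lambda>a. C a v)"
  shows eval_prefix_add_left: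
      "eval_prefix n (\<lambda>v. G v + H v) C w = eval_prefix n G C w + eval_prefix n H C w"
    and eval_prefix_diff_left:
      "eval_prefix n (\<lambda>v. G v - H v) C w = eval_prefix n G C w - eval_prefix n H C w"
    and eval_prefix_scale_left:
      "eval_prefix n (\<lambda>v. sA c (G v)) C w = sA c (eval_prefix n G C w)"
  by (simp_all add: eval_prefix_def linear_add[OF C] linear_diff[OF C] linear_scale[OF C])

lemma eval_prefix_Cons [simp]:
  "eval_prefix (Suc n) G C (u # w) = eval_prefix n (\<lambda>v. G (u # v)) C w"
  by (simp add: eval_prefix_def)

text \<open>On both sides \<open>H\<close> reads the first \<open>h\<close> letters,
  \<open>G\<close> takes the value of \<open>H\<close> as parameter and reads the next
  \<open>n\<close>, and \<open>C\<close> gets the rest.\<close>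

lemma eval_prefix_nested:
  "eval_prefix h H (\<lambda>b. eval_prefix n (G b) C) w =
    eval_prefix (n + h) (eval_prefix h H G) C w"
  by (auto simp: eval_prefix_def drop_take min_def add.commute)

lemma act_head_eval_prefix_Suc:
  "act_head (eval_prefix (Suc n) G C) a w = eval_prefix (Suc n) (act_head G a) C w"
  by (cases w) (simp_all add: eval_prefix_def)

text \<open>If \<open>G\<close> reads a letter, \<open>a\<close> acts on a letter of
  \<open>G\<close>. If \<open>n = 0\<close>, the continuation \<open>act_head F\<close> turns two
  successive actions into the product \<open>G [] * a\<close>.\<close>

lemma act_head_eval_prefix:
  "act_head (eval_prefix n G (act_head F)) a w =
    eval_prefix n (act_head G a) (act_head F) w"
  by (cases w; cases n) (auto simp: eval_prefix_def lact_mult mult.assoc)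

text \<open>The two orders differ only in the first gap: either \<open>G\<close> reads the letter on
  which \<open>a\<close> acts, or its value is multiplied by \<open>a\<close>. In the later gaps
  they agree because left and right actions commute.\<close>

lemma act_head_insertion:
  assumes "multilinear F"
  shows "act_head (insertion n G F) a w = insertion n G (act_head F a) w +
    eval_prefix n (act_head G a) (act_head F) w - eval_prefix n G (\<lambda>b. act_head F (a * b)) w"
  using act_head_eval_prefix[of n G F a w]
  by (cases w) (auto simp: eval_prefix_def act_head_act_head act_head_add lact_ract algebra_simps)

lemma insertion_short: "length w < n \<Longrightarrow> insertion n G F w = 0"
  by (induction w arbitrary: F) (simp_all add: eval_prefix_def)

text \<open>\<open>G\<close> must read the whole word, so only the first gap counts, and it is also
  the last one.\<close>

lemma insertion_same_length: "length w = n \<Longrightarrow> insertion n G F w = F [] * G w"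
  by (cases w) (simp_all add: eval_prefix_def insertion_short)

text \<open>
  A graded Leibniz rule. The last term corrects for the last gap of \<open>G\<close>, where inserting \<open>H\<close> into \<open>G\<close>
  multiplies the value of \<open>G\<close>; the left-hand side has no such term.
\<close>

lemma insertion_eval_prefix:
  assumes C: "\<And>v. Vector_Spaces.linear sA sA (\<lambda>a. C a v)"
  shows "insertion h H (eval_prefix n G C) w =
    eval_prefix (n + h) (insertion h H G) C w
    + sA ((-1) ^ (n * h)) (eval_prefix n G (\<lambda>a. insertion h H (C a)) w
        - eval_prefix n G (\<lambda>a. eval_prefix h H (\<lambda>b. C (a * b))) w)"
proof (induction n arbitrary: G w)
  case 0
  have "eval_prefix 0 G C = C (G [])"
    by (simp add: eval_prefix_def fun_eq_iff)
  \<comment> \<open>When \<open>G\<close> reads no letter, the first and the correction term on the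
    right cancel: both multiply \<open>G []\<close> by the value of \<open>H\<close>.\<close>
  then show ?case
    by (simp add: eval_prefix_def insertion_same_length)
next
  case (Suc n)
  show ?case
  proof (cases w)
    case Nil
    then show ?thesis by (simp add: eval_prefix_def)
  next
    case (Cons u z)
    note left = eval_prefix_left[where C = C, OF C]
    have "eval_prefix (Suc n + h) (insertion h H G) C w =
        eval_prefix (n + h) (\<lambda>v. eval_prefix h H (act_head G) (u # v)) C z
        + sA ((-1) ^ h) (eval_prefix (n + h) (insertion h H (\<lambda>v. G (u # v))) C z
            - eval_prefix (n + h) (eval_prefix h H (\<lambda>a v. G (ract u a # v))) C z)"
      by (simp add: Cons left)
    \<comment> \<open>Since \<open>G\<close> reads at least one letter, the value of
      \<open>H\<close> in the first gap acts on a letter of \<open>G\<close> and never reaches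
      \<open>C\<close>.\<close>
    moreover have "eval_prefix h H (act_head (eval_prefix (Suc n) G C)) w =
        eval_prefix (n + h) (\<lambda>v. eval_prefix h H (act_head G) (u # v)) C z"
    proof -
      have "act_head (eval_prefix (Suc n) G C) = (\<lambda>b. eval_prefix (Suc n) (act_head G b) C)"
        by (simp add: fun_eq_iff act_head_eval_prefix_Suc)
      then show ?thesis by (simp only: eval_prefix_nested Cons) simp
    qed
    moreover have "eval_prefix h H (\<lambda>a v. eval_prefix (Suc n) G C (ract u a # v)) z =
        eval_prefix (n + h) (eval_prefix h H (\<lambda>a v. G (ract u a # v))) C z"
      using eval_prefix_nested[of h H n "\<lambda>a v. G (ract u a # v)" C z] by simp
    ultimately show ?thesis
      using Suc.IH[of "\<lambda>v. G (u # v)" z]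
      by (simp add: Cons power_add A.scale_right_distrib A.scale_right_diff_distrib)
  qed
qed

text \<open>For the continuation \<open>act_head F\<close>, the correction with \<open>a * b\<close>
  is absorbed by \<open>act_head_insertion\<close>; what remains is the value of \<open>G\<close>
  acting at the head of \<open>H\<close>.\<close>

lemma insertion_eval_prefix_act_head:
  assumes F: "multilinear F"
  shows "insertion h H (eval_prefix n G (act_head F)) w =
    eval_prefix (n + h) (insertion h H G) (act_head F) w
    + sA ((-1) ^ (n * h)) (eval_prefix n G (act_head (insertion h H F)) w
        - eval_prefix (n + h) (eval_prefix n G (act_head H)) (act_head F) w)"
proof -
  have "act_head (insertion h H F) = (\<lambda>a v. insertion h H (act_head F a) v +
      eval_prefix h (act_head H a) (act_head F) v - eval_prefix h H (\<lambda>b. act_head F (a * b)) v)"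
    by (simp add: fun_eq_iff act_head_insertion[OF F])
  then have "eval_prefix n G (act_head (insertion h H F)) w =
      eval_prefix n G (\<lambda>a. insertion h H (act_head F a)) w
      + eval_prefix (n + h) (eval_prefix n G (act_head H)) (act_head F) w
      - eval_prefix n G (\<lambda>a. eval_prefix h H (\<lambda>b. act_head F (a * b))) w"
    using eval_prefix_nested[of n G h "act_head H" "act_head F" w]
    by (simp add: eval_prefix_add eval_prefix_diff add.commute)
  then show ?thesis
    by (simp add: insertion_eval_prefix[where C = "act_head F", OF linear_act_head[OF F]])
qed

text \<open>Sorts the terms by their position relative to \<open>u\<close>. Those in the last group
  lie entirely behind \<open>u\<close>, which gives the sign \<open>(-1) ^ (n + h)\<close>;
  \<open>E\<close> records right actions on \<open>u\<close>.\<close>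

lemma insertion_insertion_Cons:
  fixes F u
  assumes F: "multilinear F"
  defines "E \<equiv> \<lambda>a v. F (ract u a # v)"
  shows "insertion h H (insertion n G F) (u # w) =
    eval_prefix (n + h) (insertion h H G) (act_head F) (u # w)
    + sA ((-1) ^ (n * h)) (eval_prefix n G (act_head (insertion h H F)) (u # w)
        - eval_prefix (n + h) (eval_prefix n G (act_head H)) (act_head F) (u # w))
    + eval_prefix h H (act_head (insertion n G F)) (u # w)
    - eval_prefix (n + h) (eval_prefix h H (act_head G)) (act_head F) (u # w)
    + sA ((-1) ^ (n + h)) (insertion h H (insertion n G (\<lambda>v. F (u # v))) w
        - eval_prefix (n + h) (insertion h H G) E w
        - sA ((-1) ^ (n * h)) (eval_prefix n G (\<lambda>a. insertion h H (E a)) w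
            - eval_prefix n G (\<lambda>a. eval_prefix h H (\<lambda>b. E (a * b))) w)
        - eval_prefix h H (\<lambda>a. insertion n G (E a)) w
        + eval_prefix h H (\<lambda>a. eval_prefix n G (\<lambda>b. E (a * b))) w)"
proof -
  let ?P = "eval_prefix n G (act_head F)"
  have E: "\<And>v. Vector_Spaces.linear sA sA (\<lambda>a. E a v)"
    unfolding E_def by (rule linear_ract_first[OF F])
  have P: "eval_prefix h H (act_head ?P) (u # w) =
      eval_prefix (n + h) (eval_prefix h H (act_head G)) (act_head F) (u # w)"
    by (simp add: act_head_eval_prefix[abs_def] eval_prefix_nested del: eval_prefix_Cons)
  \<comment> \<open>By its recursion, the insertion into \<open>?P\<close> on \<open>u # w\<close>
    is its front term plus this tail, and \<open>P\<close> evaluates the front term.\<close>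
  have 1: "sA ((-1) ^ h) (insertion h H (\<lambda>v. ?P (u # v)) w - eval_prefix h H (\<lambda>a v. ?P (ract u a # v)) w)
     = insertion h H ?P (u # w) - eval_prefix (n + h) (eval_prefix h H (act_head G)) (act_head F) (u # w)"
    by (simp add: P)
  have 2: "insertion h H (\<lambda>v. insertion n G F (u # v)) w = insertion h H (\<lambda>v. ?P (u # v)) w
     + sA ((-1) ^ n) (insertion h H (insertion n G (\<lambda>v. F (u # v))) w - insertion h H (eval_prefix n G E) w)"
    by (simp add: insertion_add insertion_scale insertion_diff E_def)
  \<comment> \<open>The value of \<open>H\<close> acts on \<open>u\<close> first and that of
    \<open>G\<close> second; \<open>ract_mult\<close> merges the two into an action of
    \<open>a * b\<close>.\<close>
  have 3: "eval_prefix h H (\<lambda>a v. insertion n G F (ract u a # v)) w = eval_prefix h H (\<lambda>a v. ?P (ract u a # v)) w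
     + sA ((-1) ^ n) (eval_prefix h H (\<lambda>a. insertion n G (E a)) w
          - eval_prefix h H (\<lambda>a. eval_prefix n G (\<lambda>b. E (a * b))) w)"
    by (simp add: eval_prefix_add eval_prefix_scale eval_prefix_diff E_def ract_mult)
  have "insertion h H (insertion n G F) (u # w) = eval_prefix h H (act_head (insertion n G F)) (u # w)
     + sA ((-1) ^ h) (insertion h H (\<lambda>v. ?P (u # v)) w - eval_prefix h H (\<lambda>a v. ?P (ract u a # v)) w)
     + sA ((-1) ^ (n + h)) (insertion h H (insertion n G (\<lambda>v. F (u # v))) w - insertion h H (eval_prefix n G E) w
          - (eval_prefix h H (\<lambda>a. insertion n G (E a)) w
          - eval_prefix h H (\<lambda>a. eval_prefix n G (\<lambda>b. E (a * b))) w))"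
    unfolding insertion.simps(2)[of h H "insertion n G F"] 2 3
    by (simp add: power_add mult.commute A.scale_right_distrib A.scale_right_diff_distrib)
  then show ?thesis
    unfolding 1 insertion_eval_prefix[where C = E, OF E] insertion_eval_prefix_act_head[OF F]
    by (simp add: algebra_simps)
qed

text \<open>
  The graded pre-Lie identity. It is proved by induction on the word, for all \<open>F\<close> at once:
  apart from the inductive instance, \<open>insertion_insertion_Cons\<close> produces only terms with an
  insertion next to the first letter, and those that are not part of the right-hand side are
  symmetric under exchange of \<open>G\<close> and \<open>H\<close>.
\<close>

lemma insertion_commutator:
  assumes F: "multilinear F"
  shows "insertion h H (insertion n G F) w - sA ((-1) ^ (n * h)) (insertion n G (insertion h H F) w) =
    insertion (n + h) (\<lambda>v. insertion h H G v - sA ((-1) ^ (n * h)) (insertion n G H v)) F w"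
  using F
proof (induction w arbitrary: F)
  case Nil
  then show ?case
    by (simp add: eval_prefix_def algebra_simps A.scale_mult_right)
next
  case (Cons u w)
  note left = eval_prefix_diff_left eval_prefix_scale_left
  note head = left[OF linear_act_head[OF Cons.prems]]
  note tail = left[OF linear_ract_first[OF Cons.prems]]
  define \<sigma> :: 'k where "\<sigma> = (-1) ^ (n * h)"
  \<comment> \<open>As \<open>\<sigma>\<close> squares to one, the swapped expansion multiplied by
    \<open>\<sigma>\<close> has the same coefficients on the symmetric terms, so they
    cancel.\<close>
  have \<sigma>: "(-1) ^ (h * n) = \<sigma>" "sA \<sigma> (sA \<sigma> x) = x" for x
    by (simp_all add: \<sigma>_def mult.commute flip: power_mult_distrib)
  have IH: "insertion h H (insertion n G (\<lambda>v. F (u # v))) w =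
      insertion (n + h) (\<lambda>v. insertion h H G v - sA \<sigma> (insertion n G H v)) (\<lambda>v. F (u # v)) w
      + sA \<sigma> (insertion n G (insertion h H (\<lambda>v. F (u # v))) w)"
    using Cons.IH[OF multilinear_Cons[OF Cons.prems], of u] by (simp add: \<sigma>_def diff_eq_eq)
  show ?case
    unfolding insertion_insertion_Cons[OF Cons.prems] insertion.simps(2)[of "n + h"] \<sigma>_def[symmetric] head tail
      add.commute[of h n] \<sigma> IH
    by (simp only: A.scale_right_distrib A.scale_right_diff_distrib \<sigma> A.scale_left_commute[of \<sigma> "(-1) ^ (n + h)"])
       simp
qed

subsection \<open>Homogeneous cochains and their bracket\<close>

definition homogeneous :: "nat \<Rightarrow> ('m list \<Rightarrow> 'a) set"
  where "homogeneous n = {F. (\<forall>w. length w \<noteq> n \<longrightarrow> F w = 0) \<and> multilinear F}"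

text \<open>The parameter \<open>x\<close> will be the first letter of a word, on which
  \<open>F\<close> depends linearly.\<close>

lemma linear_insertion:
  assumes "\<And>w. Vector_Spaces.linear s sA (\<lambda>x. F x w)"
  shows "Vector_Spaces.linear s sA (\<lambda>x. insertion n G (F x) w)"
proof -
  have "F (x + y) = (\<lambda>w. F x w + F y w)" "F (s c x) = (\<lambda>w. sA c (F x w))" for x y c
    using linear_add[OF assms] linear_scale[OF assms] by auto
  then show ?thesis
    using assms by (simp add: Vector_Spaces.linear_iff insertion_add insertion_scale)
qed

text \<open>The varied letter is among those read by \<open>G\<close>, so linearity passes through
  \<open>G\<close> and then through \<open>C\<close>.\<close>

lemma linear_eval_prefix_left:
  assumes C: "\<And>v. Vector_Spaces.linear sA sA (\<lambda>a. C a v)"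
    and G: "multilinear G" and n: "length xs < n"
  shows "Vector_Spaces.linear sM sA (\<lambda>u. eval_prefix n G C (xs @ u # ys))"
proof (cases "n \<le> length xs + Suc (length ys)")
  case True
  obtain k where k: "n - length xs = Suc k"
    using n by (metis Suc_diff_Suc)
  have "Vector_Spaces.linear sM sA (\<lambda>u. G (xs @ u # take k ys))"
    using G by (simp add: multilinear_def)
  from Vector_Spaces.linear_compose[OF this C[of "drop k ys"]] show ?thesis
    using True n k by (simp add: eval_prefix_def o_def)
next
  case False
  then show ?thesis
    using A.vector_space_axioms M.vector_space_axioms
    by (simp add: eval_prefix_def Vector_Spaces.linear_iff)
qed

lemma linear_act_head_letter:
  assumes "multilinear F"
  shows "Vector_Spaces.linear sM sA (\<lambda>u. act_head F a (xs @ u # ys))"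
proof (cases xs)
  case Nil
  with Vector_Spaces.linear_compose[OF linear_lact[of a] linear_first[OF assms, of ys]]
  show ?thesis by (simp add: o_def)
next
  case (Cons x xs')
  with assms[unfolded multilinear_def, rule_format, of "lact a x # xs'" ys]
  show ?thesis by simp
qed

lemma linear_eval_prefix_right:
  assumes "Vector_Spaces.linear sM sA (\<lambda>u. C (G (take n xs)) (drop n xs @ u # ys))"
    and "n \<le> length xs"
  shows "Vector_Spaces.linear sM sA (\<lambda>u. eval_prefix n G C (xs @ u # ys))"
  using assms by (simp add: eval_prefix_def)

lemma linear_sum_scaled:
  assumes f: "Vector_Spaces.linear sM sA f" and g: "Vector_Spaces.linear sM sA g"
  shows "Vector_Spaces.linear sM sA (\<lambda>x. sA c (f x) + sA d (g x))"
  unfolding Vector_Spaces.linear_iff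
  by (simp add: A.vector_space_axioms M.vector_space_axioms linear_add[OF f] linear_add[OF g]
      linear_scale[OF f] linear_scale[OF g] A.scale_right_distrib mult.commute)

lemma linear_add_scaled_diff:
  assumes "Vector_Spaces.linear sM sA f" "Vector_Spaces.linear sM sA g" "Vector_Spaces.linear sM sA h"
  shows "Vector_Spaces.linear sM sA (\<lambda>x. f x + sA c (g x - h x))"
  using linear_sum_scaled[OF assms(1) linear_sum_scaled[OF assms(2,3), of 1 "- 1"], of 1 c] by simp

text \<open>Induction on the letters before the varied one, for all \<open>F\<close> because the
  recursion fixes the first letter.\<close>

lemma multilinear_insertion:
  assumes F: "multilinear F" and G: "multilinear G"
  shows "multilinear (insertion n G F)"
  unfolding multilinear_def
proof (intro allI)
  fix xs ys
  show "Vector_Spaces.linear sM sA (\<lambda>u. insertion n G F (xs @ u # ys))"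
    using F
  proof (induction xs arbitrary: F)
    case Nil
    \<comment> \<open>For \<open>n = 0\<close> the varied letter stays with \<open>F\<close> and is
      acted on; otherwise \<open>G\<close> reads it.\<close>
    have 1: "Vector_Spaces.linear sM sA (\<lambda>u. eval_prefix n G (act_head F) (u # ys))"
      using linear_eval_prefix_left[where C = "act_head F" and xs = "[]", OF linear_act_head[OF Nil] G, of n ys]
        linear_eval_prefix_right[of "act_head F" G n "[]" ys] linear_act_head_letter[OF Nil, of _ "[]" ys]
      by (cases n) auto
    have 2: "Vector_Spaces.linear sM sA (\<lambda>u. insertion n G (\<lambda>v. F (u # v)) ys)"
      by (rule linear_insertion[OF linear_first[OF Nil]])
    have 3: "Vector_Spaces.linear sM sA (\<lambda>u. eval_prefix n G (\<lambda>a v. F (ract u a # v)) ys)"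
    proof (cases "n \<le> length ys")
      case True
      with Vector_Spaces.linear_compose[OF linear_ract linear_first[OF Nil, of "drop n ys"]]
      show ?thesis by (simp add: eval_prefix_def o_def)
    next
      case False
      then show ?thesis
        using A.vector_space_axioms M.vector_space_axioms
        by (simp add: eval_prefix_def Vector_Spaces.linear_iff)
    qed
    show ?case
      using linear_add_scaled_diff[OF 1 2 3] by simp
  next
    case (Cons x xs)
    note E = linear_ract_first[OF Cons.prems]
    have 1: "Vector_Spaces.linear sM sA (\<lambda>u. eval_prefix n G (act_head F) ((x # xs) @ u # ys))"
      by (cases "n \<le> length (x # xs)")
        (use linear_eval_prefix_left[where C = "act_head F", OF linear_act_head[OF Cons.prems] G]
          linear_eval_prefix_right[OF linear_act_head_letter[OF Cons.prems]] in \<open>simp_all only: not_le\<close>)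
    have 2: "Vector_Spaces.linear sM sA (\<lambda>u. insertion n G (\<lambda>v. F (x # v)) (xs @ u # ys))"
      by (rule Cons.IH[OF multilinear_Cons[OF Cons.prems]])
    have 3: "Vector_Spaces.linear sM sA (\<lambda>u. eval_prefix n G (\<lambda>a v. F (ract x a # v)) (xs @ u # ys))"
    proof (cases "n \<le> length xs")
      case True
      then show ?thesis
        using Cons.prems[unfolded multilinear_def, rule_format, of "ract x (G (take n xs)) # drop n xs" ys]
        by (intro linear_eval_prefix_right) simp_all
    next
      case False
      then show ?thesis by (intro linear_eval_prefix_left E G) simp
    qed
    show ?case
      using linear_add_scaled_diff[OF 1 2 3] by simp
  qed
qed

lemma insertion_eq_0:
  assumes "\<And>w. length w \<noteq> m \<Longrightarrow> F w = 0" and "length w \<noteq> m + n"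
  shows "insertion n G F w = 0"
  using assms
proof (induction w arbitrary: F m)
  case Nil
  then show ?case using Nil(1)[of "[]"] by (auto simp: eval_prefix_def)
next
  case (Cons u w)
  have F: "length v \<noteq> m \<Longrightarrow> F v = 0" for v
    by (rule Cons.prems)
  have "act_head F a v = 0" if "length v \<noteq> m" for a v
    using that by (cases v) (simp_all add: F)
  then have 1: "eval_prefix n G (act_head F) (u # w) = 0"
    using Cons.prems(2) by (auto simp: eval_prefix_def)
  have 2: "eval_prefix n G (\<lambda>a v. F (ract u a # v)) w = 0"
    using Cons.prems(2) by (auto simp: eval_prefix_def F)
  have "insertion n G (\<lambda>v. F (u # v)) w = 0"
  proof (cases m)
    \<comment> \<open>There is no smaller degree to induct on, but here \<open>F (u # v)\<close>
      vanishes for every \<open>v\<close>.\<close>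
    case 0
    then show ?thesis
      using insertion_scale[of n G 0 "\<lambda>_. 0" w] by (simp add: F)
  next
    case (Suc k)
    then show ?thesis
      using Cons.prems(2) by (intro Cons.IH[of k]) (auto simp: F)
  qed
  with 1 2 show ?case by simp
qed

lemma insertion_homogeneous:
  assumes "F \<in> homogeneous m" "G \<in> homogeneous n"
  shows "insertion n G F \<in> homogeneous (m + n)"
  using assms insertion_eq_0[of m F _ n G]
  by (auto simp: homogeneous_def multilinear_insertion)

lemma multilinear_sum_scaled:
  assumes "multilinear F" "multilinear G"
  shows "multilinear (\<lambda>w. sA c (F w) + sA d (G w))"
  using assms unfolding multilinear_def by (intro allI linear_sum_scaled) blast+

text \<open>The degrees are arguments because a function such as zero does not determine its own
  degree. In this argument order \<open>insertion n G F\<close> is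
  \<open>F \<lhd> G\<close>.\<close>

definition deg_bracket :: "nat \<Rightarrow> nat \<Rightarrow> ('m list \<Rightarrow> 'a) \<Rightarrow> ('m list \<Rightarrow> 'a) \<Rightarrow> 'm list \<Rightarrow> 'a"
  where "deg_bracket m n F G w = insertion n G F w - sA ((-1) ^ (m * n)) (insertion m F G w)"

lemma deg_bracket_homogeneous:
  assumes "F \<in> homogeneous m" "G \<in> homogeneous n"
  shows "deg_bracket m n F G \<in> homogeneous (m + n)"
  using insertion_homogeneous[OF assms] insertion_homogeneous[OF assms(2,1)]
    multilinear_sum_scaled[of "insertion n G F" "insertion m F G" 1 "- ((-1) ^ (m * n))"]
  by (simp add: homogeneous_def deg_bracket_def[abs_def] add.commute)

lemma deg_bracket_antisym:
  "deg_bracket m n F G w = - sA ((-1) ^ (m * n)) (deg_bracket n m G F w)"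
  by (cases "even (m * n)") (simp_all add: deg_bracket_def mult.commute)

lemma insertion_left:
  assumes "multilinear F"
  shows insertion_add_left: "insertion n (\<lambda>v. G v + H v) F w = insertion n G F w + insertion n H F w"
    and insertion_scale_left: "insertion n (\<lambda>v. sA c (G v)) F w = sA c (insertion n G F w)"
  using assms
  by (induction w arbitrary: F)
    (simp_all add: eval_prefix_left linear_act_head linear_ract_first multilinear_Cons A.scale_right_distrib
      A.scale_right_diff_distrib mult.commute)

text \<open>The pre-Lie identity turns each insertion of a bracket into a commutator of two
  insertions. All terms are then double insertions, which cancel in pairs.\<close>

lemma deg_bracket_jacobi:
  assumes F: "multilinear F" and G: "multilinear G" and H: "multilinear H"
  shows "deg_bracket l (m + n) F (deg_bracket m n G H) w =
    deg_bracket (l + m) n (deg_bracket l m F G) H w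
    + sA ((-1) ^ (l * m)) (deg_bracket m (l + n) G (deg_bracket l n F H) w)"
proof -
  have 1: "insertion (m + n) (deg_bracket m n G H) F w =
     insertion n H (insertion m G F) w - sA ((-1) ^ (m * n)) (insertion m G (insertion n H F) w)"
    using insertion_commutator[OF F, of n H m G w] by (simp add: deg_bracket_def[abs_def])
  have 2: "insertion (l + n) (deg_bracket l n F H) G w =
     insertion n H (insertion l F G) w - sA ((-1) ^ (l * n)) (insertion l F (insertion n H G) w)"
    using insertion_commutator[OF G, of n H l F w] by (simp add: deg_bracket_def[abs_def])
  have 3: "insertion (l + m) (deg_bracket l m F G) H w =
     insertion m G (insertion l F H) w - sA ((-1) ^ (l * m)) (insertion l F (insertion m G H) w)"
    using insertion_commutator[OF H, of m G l F w] by (simp add: deg_bracket_def[abs_def])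
  have 4: "insertion k K (deg_bracket p q P Q) w = insertion k K (insertion q Q P) w
     - sA ((-1) ^ (p * q)) (insertion k K (insertion p P Q) w)" for k K p q P Q
    by (simp add: deg_bracket_def[abs_def] insertion_diff insertion_scale)
  show ?thesis
    unfolding deg_bracket_def[of l "m + n"] deg_bracket_def[of "l + m" n] deg_bracket_def[of m "l + n"] 1 2 3 4
    \<comment> \<open>All signs depend only on the parities of the degrees.\<close>
    by (cases "even l"; cases "even m"; cases "even n") simp_all
qed


text \<open>The gap after \<open>k\<close> letters has sign \<open>(-1) ^ (k * n)\<close>. The left
  action on the \<open>i\<close>-th letter left to \<open>F\<close> comes from gap
  \<open>i - 1\<close>, the right action from gap \<open>i\<close>, the product from gap
  \<open>m\<close>.\<close>

lemma insertion_sum: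
  assumes "length w = m + n"
  shows "insertion n G F w =
    (\<Sum>i=1..m. sA ((-1) ^ ((i - 1) * n))
      (F (take (i - 1) w @ [lact (G (take n (drop (i - 1) w))) (w ! (i + n - 1))] @ drop (i + n) w)))
    - (\<Sum>i=1..m. sA ((-1) ^ (i * n))
      (F (take (i - 1) w @ [ract (w ! (i - 1)) (G (take n (drop i w)))] @ drop (i + n) w)))
    + sA ((-1) ^ (m * n)) (F (take m w) * G (drop m w))"
  using assms
proof (induction m arbitrary: F w)
  case 0
  then show ?case by (simp add: insertion_same_length)
next
  case (Suc m)
  then obtain u z where w: "w = u # z" and z: "length z = m + n"
    by (cases w) auto
  \<comment> \<open>These two terms are the summands \<open>i = 1\<close>; the induction hypothesis
    gives the others after an index shift.\<close>
  have "eval_prefix n G (act_head F) w = F (lact (G (take n w)) (w ! n) # drop (Suc n) w)"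
    using Suc.prems Cons_nth_drop_Suc[of n w]
    by (metis act_head.simps(2) eval_prefix_def le_add2 less_add_same_cancel2 zero_less_Suc)
  moreover have "eval_prefix n G (\<lambda>a v. F (ract u a # v)) z = F (ract u (G (take n z)) # drop n z)"
    using z by (simp add: eval_prefix_def)
  ultimately show ?case
    using Suc.IH[OF z, of "\<lambda>v. F (u # v)"]
    unfolding w One_nat_def sum.atLeast1_atMost_eq sum.lessThan_Suc_shift
    by (simp add: power_add A.scale_right_distrib A.scale_right_diff_distrib A.scale_sum_right)
qed

lemma insertion_zero [simp]: "insertion n G (\<lambda>_. 0) w = 0"
  using insertion_scale[of n G 0 "\<lambda>_. 0" w] by simp

lemma insertion_by_zero [simp]: "multilinear F \<Longrightarrow> insertion n (\<lambda>_. 0) F w = 0"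
  using insertion_scale_left[of F n 0 "\<lambda>_. 0" w] by simp

end

subsection \<open>The product algebra\<close>

text \<open>Makes \<open>A \<oplus> A\<close> a ring type, so that the locale of bimodules can be
  instantiated with it.\<close>

instantiation prod :: (times, times) times
begin

definition times_prod where "x * y = (fst x * fst y, snd x * snd y)"

instance ..

end

lemma fst_times [simp]: "fst (x * y) = fst x * fst y"
  and snd_times [simp]: "snd (x * y) = snd x * snd y"
  by (simp_all add: times_prod_def)

instance prod :: (ring, ring) ring
  by standard (simp_all add: times_prod_def distrib_left distrib_right mult.assoc plus_prod_def)

lemma sum_fun_apply: "(\<Sum>i\<in>I. f i) x = (\<Sum>i\<in>I. f i x)"
  by (induction I rule: infinite_finite_induct) simp_all

lemma linear_Pair_iff:
  assumes "vector_space s" "vector_space sA"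
  shows "Vector_Spaces.linear s (module_prod.scale sA sA) f \<longleftrightarrow>
    Vector_Spaces.linear s sA (\<lambda>x. fst (f x)) \<and> Vector_Spaces.linear s sA (\<lambda>x. snd (f x))"
proof -
  interpret vector_space_prod sA sA
    using assms by (simp add: vector_space_prod_def vector_space_pair_def)
  show ?thesis
    using assms p.vector_space_axioms
    by (auto simp: Vector_Spaces.linear_iff scale_def prod_eq_iff)
qed

section \<open>Pair-valued cochains and their explicit bracket\<close>

context algebra_bimodule
begin

abbreviation pair_scale :: "'k \<Rightarrow> 'a \<times> 'a \<Rightarrow> 'a \<times> 'a"
  where "pair_scale \<equiv> module_prod.scale sA sA"

sublocale P: vector_space_prod sA sA
  by unfold_locales

text \<open>The two sides may act through different projections, since the compatibility of left and
  right action holds for any two elements of \<open>A\<close>.\<close>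

lemma pair_bimodule: "algebra_bimodule pair_scale sM (\<lambda>a. lact (fst a)) (\<lambda>u a. ract u (snd a))"
proof -
  have fst_lin: "Vector_Spaces.linear pair_scale sA fst" and snd_lin: "Vector_Spaces.linear pair_scale sA snd"
    using A.vector_space_axioms P.p.vector_space_axioms
    by (auto simp: Vector_Spaces.linear_iff P.scale_def)
  show ?thesis
    using P.p.vector_space_axioms M.vector_space_axioms linear_lact linear_ract
      Vector_Spaces.linear_compose[OF fst_lin linear_lact_algebra]
      Vector_Spaces.linear_compose[OF snd_lin linear_ract_algebra]
    by (simp add: algebra_bimodule_def assoc_algebra_def algebra_bimodule_axioms_def
        assoc_algebra_axioms_def P.scale_def times_prod_def A.scale_mult_left A.scale_mult_right
        lact_mult ract_mult lact_ract o_def)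
qed

interpretation pair: algebra_bimodule pair_scale sM "\<lambda>a. lact (fst a)" "\<lambda>u a. ract u (snd a)"
  by (rule pair_bimodule)

lemma cochains_deg_eq: "cochains_deg sA sM n = pair.homogeneous n"
proof -
  have "(\<forall>w i. length w = n \<longrightarrow> i < n \<longrightarrow> Vector_Spaces.linear sM pair_scale (\<lambda>u. F (w[i := u])))
      \<longleftrightarrow> pair.multilinear F" if 0: "\<And>w. length w \<noteq> n \<Longrightarrow> F w = 0" for F :: "('m, 'a) cochain"
  proof
    assume L: "\<forall>w i. length w = n \<longrightarrow> i < n \<longrightarrow> Vector_Spaces.linear sM pair_scale (\<lambda>u. F (w[i := u]))"
    show "pair.multilinear F"
      unfolding pair.multilinear_def
    proof (intro allI)
      fix xs ys
      show "Vector_Spaces.linear sM pair_scale (\<lambda>u. F (xs @ u # ys))"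
      proof (cases "Suc (length xs + length ys) = n")
        case True
        \<comment> \<open>The entry \<open>0\<close> is a placeholder that the list update
          overwrites.\<close>
        then show ?thesis
          using L[rule_format, of "xs @ 0 # ys" "length xs"] by simp
      next
        case False
        then show ?thesis
          using M.vector_space_axioms P.p.vector_space_axioms by (simp add: 0 Vector_Spaces.linear_iff)
      qed
    qed
  next
    assume "pair.multilinear F"
    then show "\<forall>w i. length w = n \<longrightarrow> i < n \<longrightarrow> Vector_Spaces.linear sM pair_scale (\<lambda>u. F (w[i := u]))"
      by (simp add: pair.multilinear_def upd_conv_take_nth_drop)
  qed
  then show ?thesis
    by (auto simp: cochains_deg_def pair.homogeneous_def)
qed

text \<open>Both insertions are expanded by \<open>insertion_sum\<close>. Their last gaps give the
  two products; the sign of the second one squares to one.\<close>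

lemma bracket_deg_eq:
  assumes F: "F \<in> pair.homogeneous m" and G: "G \<in> pair.homogeneous n"
  shows "bracket_deg sA lact ract m n F G = pair.deg_bracket m n F G"
proof
  fix w
  show "bracket_deg sA lact ract m n F G w = pair.deg_bracket m n F G w"
  proof (cases "length w = m + n")
    case True
    then have "length w = n + m" by simp
    show ?thesis
      unfolding bracket_deg_def bracket_component_def pair.deg_bracket_def
        pair.insertion_sum[OF True] pair.insertion_sum[OF \<open>length w = n + m\<close>]
      using True
      by (cases "even (m * n)")
        (simp_all add: prod_eq_iff fst_sum snd_sum P.scale_def mult.commute[of n m] algebra_simps)
  next
    case False
    then show ?thesis
      using pair.deg_bracket_homogeneous[OF F G]
      by (simp add: bracket_deg_def pair.homogeneous_def)
  qed
qed

lemma cochain_bracket_deg: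
  assumes F: "F \<in> pair.homogeneous m" and G: "G \<in> pair.homogeneous n"
  shows "cochain_bracket sA lact ract F G = pair.deg_bracket m n F G"
  using cochain_bracket_homogeneous[of F m G n] assms by (simp add: cochains_deg_eq bracket_deg_eq)

section \<open>The direct sum of the homogeneous parts\<close>

lemma vector_space_cochain: "vector_space (cochain_scale sA)"
  by unfold_locales
    (simp_all add: cochain_scale_def fun_eq_iff P.p.scale_right_distrib P.p.scale_left_distrib)

lemma subspace_homogeneous: "module.subspace (cochain_scale sA) (pair.homogeneous n)"
proof -
  interpret V: vector_space "cochain_scale sA" by (rule vector_space_cochain)
  have "pair.multilinear 0"
    using M.vector_space_axioms P.p.vector_space_axioms
    by (simp add: pair.multilinear_def Vector_Spaces.linear_iff)
  moreover have "pair.multilinear (F + G)" "pair.multilinear (cochain_scale sA c F)"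
    if "pair.multilinear F" "pair.multilinear G" for F G c
    using pair.multilinear_sum_scaled[OF that, of 1 1] pair.multilinear_sum_scaled[OF that, of c 0]
    by (simp_all add: plus_fun_def cochain_scale_def)
  ultimately show ?thesis
    by (auto simp: V.subspace_def pair.homogeneous_def cochain_scale_def)
qed

lemma cochains_eq: "cochains sA sM =
    {F. (\<forall>n. component n F \<in> pair.homogeneous n) \<and> finite {n. component n F \<noteq> 0}}"
  by (simp add: cochains_def cochains_deg_eq)

lemma component_add: "component n (F + G) = component n F + component n G"
  and component_scale: "component n (cochain_scale sA c F) = cochain_scale sA c (component n F)"
  and component_0: "component n 0 = 0"
  by (simp_all add: component_def cochain_scale_def fun_eq_iff)

lemma component_homogeneous:
  "F \<in> pair.homogeneous m \<Longrightarrow> component n F = (if n = m then F else 0)"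
  by (auto simp: component_def pair.homogeneous_def fun_eq_iff)

lemma subspace_cochains: "module.subspace (cochain_scale sA) (cochains sA sM)"
proof -
  interpret V: vector_space "cochain_scale sA" by (rule vector_space_cochain)
  note sub = subspace_homogeneous
  have "finite {n. component n (F + G) \<noteq> 0}"
    if "finite {n. component n F \<noteq> 0}" "finite {n. component n G \<noteq> 0}" for F G :: "('m, 'a) cochain"
    by (rule finite_subset[OF _ finite_UnI[OF that]]) (auto simp: component_add)
  moreover have "finite {n. component n (cochain_scale sA c F) \<noteq> 0}"
    if "finite {n. component n F \<noteq> 0}" for F :: "('m, 'a) cochain" and c
    by (rule finite_subset[OF _ that]) (auto simp: component_scale)
  ultimately show ?thesis
    unfolding V.subspace_def cochains_eq
    by (auto simp: component_add component_scale component_0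
        V.subspace_0[OF sub] V.subspace_add[OF sub] V.subspace_scale[OF sub])
qed

lemma homogeneous_subset: "pair.homogeneous n \<subseteq> cochains sA sM"
proof
  interpret V: vector_space "cochain_scale sA" by (rule vector_space_cochain)
  fix F assume F: "F \<in> pair.homogeneous n"
  have "{m. component m F \<noteq> 0} \<subseteq> {n}"
    using component_homogeneous[OF F] by auto
  then show "F \<in> cochains sA sM"
    using F V.subspace_0[OF subspace_homogeneous]
    by (auto simp: cochains_eq component_homogeneous[OF F] intro: finite_subset)
qed

lemma component_sum: "component n (\<Sum>i\<in>I. F i) = (\<Sum>i\<in>I. component n (F i))"
  by (rule ext) (simp add: component_def sum_fun_apply)

text \<open>At a word \<open>w\<close> only degree \<open>length w\<close> contributes; if that
  degree is missing from the index set, then \<open>F w = 0\<close>.\<close>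

lemma sum_components:
  assumes "finite {n. component n F \<noteq> 0}"
  shows "F = (\<Sum>n | component n F \<noteq> 0. component n F)"
proof
  fix w
  have "(\<Sum>n | component n F \<noteq> 0. component n F w) =
      (\<Sum>n | component n F \<noteq> 0. if n = length w then F w else 0)"
    by (intro sum.cong) (auto simp: component_def)
  also have "\<dots> = F w"
    using assms by (auto simp: sum.delta component_def fun_eq_iff)
  finally show "F w = (\<Sum>n | component n F \<noteq> 0. component n F) w"
    by (simp add: sum_fun_apply)
qed

lemma graded_vector_space_cochains:
  "graded_vector_space (cochain_scale sA) (cochains sA sM) (cochains_deg sA sM)"
proof -
  interpret V: vector_space "cochain_scale sA" by (rule vector_space_cochain)
  show ?thesis
    unfolding cochains_deg_eq[abs_def]
  proof unfold_locales
    fix x assume x: "x \<in> cochains sA sM"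
    show "\<exists>!f. (\<forall>n. f n \<in> pair.homogeneous n) \<and> finite {n. f n \<noteq> 0} \<and> x = (\<Sum>n | f n \<noteq> 0. f n)"
    proof (rule ex1I[of _ "\<lambda>n. component n x"])
      show "(\<forall>n. component n x \<in> pair.homogeneous n) \<and> finite {n. component n x \<noteq> 0} \<and>
          x = (\<Sum>n | component n x \<noteq> 0. component n x)"
        using x sum_components[of x] by (simp add: cochains_eq)
      fix f assume f: "(\<forall>n. f n \<in> pair.homogeneous n) \<and> finite {n. f n \<noteq> 0} \<and> x = (\<Sum>n | f n \<noteq> 0. f n)"
      show "f = (\<lambda>n. component n x)"
      proof
        fix k
        \<comment> \<open>Uniqueness: taking the component of degree \<open>k\<close> of the sum
          leaves only \<open>f k\<close>.\<close>
        have "component k x = (\<Sum>n | f n \<noteq> 0. component k (f n))"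
          using f component_sum by metis
        also have "\<dots> = (\<Sum>n | f n \<noteq> 0. if k = n then f n else 0)"
          using f by (intro sum.cong refl component_homogeneous) blast
        also have "\<dots> = f k" using f by (auto simp: sum.delta)
        finally show "f k = component k x" by simp
      qed
    qed
  qed (use subspace_cochains subspace_homogeneous homogeneous_subset in blast)+
qed

section \<open>The bracket on the direct sum\<close>

lemma bracket_apply:
  assumes "F \<in> cochains sA sM" "G \<in> cochains sA sM"
  shows "cochain_bracket sA lact ract F G w =
    (\<Sum>m\<le>length w. pair.deg_bracket m (length w - m) (component m F) (component (length w - m) G) w)"
  using assms by (simp add: cochain_bracket_def cochains_eq bracket_deg_eq)

lemma component_bracket:
  assumes "F \<in> cochains sA sM" "G \<in> cochains sA sM"
  shows "component n (cochain_bracket sA lact ract F G) =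
    (\<Sum>m\<le>n. pair.deg_bracket m (n - m) (component m F) (component (n - m) G))"
proof
  fix w
  have "pair.deg_bracket m (n - m) (component m F) (component (n - m) G) w = 0"
    if "m \<le> n" "length w \<noteq> n" for m
    using pair.deg_bracket_homogeneous[of "component m F" m "component (n - m) G" "n - m"] assms that
    by (simp add: cochains_eq pair.homogeneous_def)
  then show "component n (cochain_bracket sA lact ract F G) w =
    (\<Sum>m\<le>n. pair.deg_bracket m (n - m) (component m F) (component (n - m) G)) w"
    by (auto simp: component_def[of n] bracket_apply[OF assms] sum_fun_apply intro!: sum.neutral[symmetric])
qed

lemma deg_bracket_0:
  "pair.multilinear G \<Longrightarrow> pair.deg_bracket m n 0 G = 0"
  "pair.multilinear F \<Longrightarrow> pair.deg_bracket m n F 0 = 0"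
  by (simp_all add: pair.deg_bracket_def fun_eq_iff zero_fun_def)

lemma deg_bracket_linear:
  assumes "pair.multilinear F" "pair.multilinear F'" "pair.multilinear G"
  shows "pair.deg_bracket m n (F + F') G w = pair.deg_bracket m n F G w + pair.deg_bracket m n F' G w"
    and "pair.deg_bracket m n G (F + F') w = pair.deg_bracket m n G F w + pair.deg_bracket m n G F' w"
    and "pair.deg_bracket m n (cochain_scale sA c F) G w = pair_scale c (pair.deg_bracket m n F G w)"
    and "pair.deg_bracket m n G (cochain_scale sA c F) w = pair_scale c (pair.deg_bracket m n G F w)"
  using assms
  by (simp_all add: pair.deg_bracket_def plus_fun_def cochain_scale_def pair.insertion_add pair.insertion_scale
      pair.insertion_left P.p.scale_right_distrib P.p.scale_right_diff_distrib mult.commute)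

lemma graded_lie_algebra_cochains:
  "graded_lie_algebra (cochain_scale sA) (cochains sA sM) (cochains_deg sA sM) (cochain_bracket sA lact ract)"
proof -
  interpret V: graded_vector_space "cochain_scale sA" "cochains sA sM" "cochains_deg sA sM"
    by (rule graded_vector_space_cochains)
  let ?b = "cochain_bracket sA lact ract"
  note sub = subspace_homogeneous
  have ml: "pair.multilinear (component n F)" if "F \<in> cochains sA sM" for n F
    using that by (simp add: cochains_eq pair.homogeneous_def)
  have scaled: "cochain_scale sA c F w = pair_scale c (F w)" for c F w
    by (simp add: cochain_scale_def)
  show ?thesis
  proof unfold_locales
    fix F G assume F: "F \<in> cochains sA sM" and G: "G \<in> cochains sA sM"
    let ?d = "\<lambda>n m. pair.deg_bracket m (n - m) (component m F) (component (n - m) G)"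
    have "?d n m \<in> pair.homogeneous n" if "m \<le> n" for m n
      using pair.deg_bracket_homogeneous[of "component m F" m "component (n - m) G" "n - m"] that F G
      by (simp add: cochains_eq)
    then have "component n (?b F G) \<in> pair.homogeneous n" for n
      unfolding component_bracket[OF F G] by (intro V.subspace_sum[OF sub]) simp
    \<comment> \<open>A nonzero component in degree \<open>n\<close> requires nonzero components of
      \<open>F\<close> and \<open>G\<close> in degrees adding up to \<open>n\<close>, so the support
      lies in a finite sumset.\<close>
    moreover have "finite {n. component n (?b F G) \<noteq> 0}"
    proof (rule finite_subset)
      let ?S = "\<lambda>F. {n. component n F \<noteq> 0}"
      show "finite ((\<lambda>(i, j). i + j) ` (?S F \<times> ?S G))"
        using F G by (simp add: cochains_eq)
      show "{n. component n (?b F G) \<noteq> 0} \<subseteq> (\<lambda>(i, j). i + j) ` (?S F \<times> ?S G)"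
      proof
        fix n assume "n \<in> {n. component n (?b F G) \<noteq> 0}"
        then obtain m where m: "m \<le> n" "?d n m \<noteq> 0"
          unfolding component_bracket[OF F G] mem_Collect_eq
          by (elim sum.not_neutral_contains_not_neutral) simp
        then have "component m F \<noteq> 0" "component (n - m) G \<noteq> 0"
          using deg_bracket_0(1)[OF ml[OF G]] deg_bracket_0(2)[OF ml[OF F]] by auto
        with m show "n \<in> (\<lambda>(i, j). i + j) ` (?S F \<times> ?S G)"
          by (intro image_eqI[of _ _ "(m, n - m)"]) auto
      qed
    qed
    ultimately show "?b F G \<in> cochains sA sM"
      by (simp add: cochains_eq)
    have cF: "cochain_scale sA c F \<in> cochains sA sM" and cG: "cochain_scale sA c G \<in> cochains sA sM" for c
      using F G V.subspace_scale[OF V.subspace_total] by blast+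
    \<comment> \<open>The linearity laws are checked at each word, where the bracket is a finite sum
      of brackets in fixed degrees.\<close>
    show "?b (cochain_scale sA c F) G = cochain_scale sA c (?b F G)" for c
      by (rule ext) (simp only: bracket_apply[OF cF G] bracket_apply[OF F G] scaled component_scale
          deg_bracket_linear(3)[OF ml[OF F] ml[OF F] ml[OF G]] P.p.scale_sum_right)
    show "?b F (cochain_scale sA c G) = cochain_scale sA c (?b F G)" for c
      by (rule ext) (simp only: bracket_apply[OF F cG] bracket_apply[OF F G] scaled component_scale
          deg_bracket_linear(4)[OF ml[OF G] ml[OF G] ml[OF F]] P.p.scale_sum_right)
    fix H assume H: "H \<in> cochains sA sM"
    have FG: "F + G \<in> cochains sA sM" and GH: "G + H \<in> cochains sA sM"
      using F G H V.subspace_add[OF V.subspace_total] by blast+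
    show "?b (F + G) H = ?b F H + ?b G H"
      by (rule ext) (simp only: plus_fun_apply bracket_apply[OF FG H] bracket_apply[OF F H]
          bracket_apply[OF G H] component_add deg_bracket_linear(1)[OF ml[OF F] ml[OF G] ml[OF H]] sum.distrib)
    show "?b F (G + H) = ?b F G + ?b F H"
      by (rule ext) (simp only: plus_fun_apply bracket_apply[OF F GH] bracket_apply[OF F G]
          bracket_apply[OF F H] component_add deg_bracket_linear(2)[OF ml[OF G] ml[OF H] ml[OF F]] sum.distrib)
  next
    fix F G m n assume "F \<in> cochains_deg sA sM m" "G \<in> cochains_deg sA sM n"
    then have F: "F \<in> pair.homogeneous m" and G: "G \<in> pair.homogeneous n"
      by (simp_all add: cochains_deg_eq)
    show "?b F G \<in> cochains_deg sA sM (m + n)"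
      using pair.deg_bracket_homogeneous[OF F G] by (simp add: cochain_bracket_deg[OF F G] cochains_deg_eq)
    show "?b F G = - cochain_scale sA ((-1) ^ (m * n)) (?b G F)"
      by (rule ext)
        (simp only: cochain_bracket_deg[OF F G] cochain_bracket_deg[OF G F] scaled fun_Compl_def
          pair.deg_bracket_antisym[of m n F G])
  next
    fix F G H l m n
    assume "F \<in> cochains_deg sA sM l" "G \<in> cochains_deg sA sM m" "H \<in> cochains_deg sA sM n"
    then have h: "F \<in> pair.homogeneous l" "G \<in> pair.homogeneous m" "H \<in> pair.homogeneous n"
      by (simp_all add: cochains_deg_eq)
    \<comment> \<open>Homogeneity of the inner brackets identifies the outer ones with
      \<open>deg_bracket\<close> in known degrees.\<close>
    note hb = pair.deg_bracket_homogeneous[OF h(2,3)] pair.deg_bracket_homogeneous[OF h(1,2)]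
      pair.deg_bracket_homogeneous[OF h(1,3)]
    show "?b F (?b G H) = ?b (?b F G) H + cochain_scale sA ((-1) ^ (l * m)) (?b G (?b F H))"
      unfolding cochain_bracket_deg[OF h(2,3)] cochain_bracket_deg[OF h(1,2)] cochain_bracket_deg[OF h(1,3)]
        cochain_bracket_deg[OF h(1) hb(1)] cochain_bracket_deg[OF hb(2) h(3)] cochain_bracket_deg[OF h(2) hb(3)]
      using h pair.deg_bracket_jacobi[of F G H l m n]
      by (intro ext) (simp only: plus_fun_apply scaled pair.homogeneous_def mem_Collect_eq)
  qed
qed

section \<open>Maurer-Cartan elements of degree one\<close>

lemma pair_cochain_homogeneous:
  assumes R: "Vector_Spaces.linear sM sA R" and S: "Vector_Spaces.linear sM sA S"
  shows "pair_cochain R S \<in> pair.homogeneous 1"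
proof -
  have "Vector_Spaces.linear sM pair_scale (\<lambda>u. (R u, S u))"
    using R S by (simp add: linear_Pair_iff[OF M.vector_space_axioms A.vector_space_axioms])
  moreover have "Vector_Spaces.linear sM pair_scale (\<lambda>u. 0)"
    using M.vector_space_axioms P.p.vector_space_axioms by (simp add: Vector_Spaces.linear_iff)
  ultimately have "Vector_Spaces.linear sM pair_scale (\<lambda>u. pair_cochain R S (xs @ u # ys))" for xs ys
    by (cases xs; cases ys; cases "tl xs") (auto simp: pair_cochain_def)
  then show ?thesis
    by (auto simp: pair.homogeneous_def pair.multilinear_def pair_cochain_def split: list.splits)
qed

text \<open>In degree one the sign of the graded commutator is \<open>-1\<close>, so the bracket of
  \<open>T\<close> with itself is twice \<open>T \<lhd> T\<close>.\<close>

lemma bracket_pair_cochain: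
  assumes R: "Vector_Spaces.linear sM sA R" and S: "Vector_Spaces.linear sM sA S"
  defines "T \<equiv> pair_cochain R S"
  defines "D \<equiv> \<lambda>u v. lact (R u) v + ract u (S v)"
  shows "cochain_bracket sA lact ract T T [u, v] =
    pair_scale 2 (R (D u v) - R u * R v, S (D u v) - S u * S v)"
proof -
  have T: "T \<in> pair.homogeneous 1"
    unfolding T_def by (rule pair_cochain_homogeneous[OF R S])
  \<comment> \<open>The first gap gives the left action of \<open>R u\<close> on \<open>v\<close>;
    the second gives the right action of \<open>S v\<close> on \<open>u\<close> and the
    products.\<close>
  have "pair.insertion 1 T T [u, v] = (R (D u v) - R u * R v, S (D u v) - S u * S v)"
    by (simp add: T_def D_def pair_cochain_def pair.eval_prefix_def linear_add[OF R] linear_add[OF S] prod_eq_iff)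
  moreover have "pair_scale 2 x = x + x" for x
    using P.p.scale_left_distrib[of 1 1 x] by simp
  ultimately show ?thesis
    by (simp add: cochain_bracket_deg[OF T T] pair.deg_bracket_def)
qed

end

theorem theorem3p2:
  fixes sA :: "'k::field_char_0 \<Rightarrow> 'a::ring \<Rightarrow> 'a"
    and sM :: "'k \<Rightarrow> 'm::ab_group_add \<Rightarrow> 'm"
    and lact :: "'a \<Rightarrow> 'm \<Rightarrow> 'm"
    and ract :: "'m \<Rightarrow> 'a \<Rightarrow> 'm"
  assumes "algebra_bimodule sA sM lact ract"
  shows "graded_lie_algebra (cochain_scale sA) (cochains sA sM) (cochains_deg sA sM)
           (cochain_bracket sA lact ract)
    \<and> (\<forall>R S. Vector_Spaces.linear sM sA R \<and> Vector_Spaces.linear sM sA S \<longrightarrow>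
         pair_cochain R S \<in> cochains_deg sA sM 1 \<and>
         (generalized_rota_baxter_system sA sM lact ract R S \<longleftrightarrow>
           maurer_cartan (cochains_deg sA sM) (cochain_bracket sA lact ract) (pair_cochain R S)))"
proof (intro conjI allI impI; (elim conjE)?)
  interpret algebra_bimodule sA sM lact ract by fact
  interpret L: graded_lie_algebra "cochain_scale sA" "cochains sA sM" "cochains_deg sA sM"
    "cochain_bracket sA lact ract"
    by (rule graded_lie_algebra_cochains)
  show "graded_lie_algebra (cochain_scale sA) (cochains sA sM) (cochains_deg sA sM)
      (cochain_bracket sA lact ract)"
    by (rule graded_lie_algebra_cochains)
  fix R S assume R: "Vector_Spaces.linear sM sA R" and S: "Vector_Spaces.linear sM sA S"
  let ?T = "pair_cochain R S"
  show T: "?T \<in> cochains_deg sA sM 1"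
    using pair_cochain_homogeneous[OF R S] by (simp add: cochains_deg_eq)
  \<comment> \<open>The bracket has degree two, so only words of two letters matter.\<close>
  have off: "cochain_bracket sA lact ract ?T ?T w = 0" if "\<nexists>u v. w = [u, v]" for w
  proof -
    have "length w \<noteq> 1 + 1"
      using that by (auto simp: length_Suc_conv)
    then show ?thesis
      using L.bracket_degree[OF T T] by (simp add: cochains_deg_def)
  qed
  have "cochain_bracket sA lact ract ?T ?T = 0 \<longleftrightarrow>
      (\<forall>u v. cochain_bracket sA lact ract ?T ?T [u, v] = 0)"
    using off by (auto simp: fun_eq_iff) metis
  moreover have "cochain_bracket sA lact ract ?T ?T [u, v] = 0 \<longleftrightarrow>
      R u * R v = R (lact (R u) v + ract u (S v)) \<and> S u * S v = S (lact (R u) v + ract u (S v))" for u v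
    \<comment> \<open>In characteristic zero the factor 2 can be cancelled.\<close>
    unfolding bracket_pair_cochain[OF R S] by (auto simp: P.scale_def zero_prod_def)
  ultimately show "generalized_rota_baxter_system sA sM lact ract R S \<longleftrightarrow>
      maurer_cartan (cochains_deg sA sM) (cochain_bracket sA lact ract) ?T"
    using R S T by (auto simp: generalized_rota_baxter_system_def maurer_cartan_def)
qed

end
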